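(* Let $k\ge 2$. In the game described in the context (starting from the empty board), Builder has a strategy such that, against every strategy of Painter, at least one of the following occurs: a red $P_3$ or a blue $P_3$ appears within the first $6k-1$ rounds; or after at most $6k-2$ rounds the board contains a bad green $P_{4k}$; or after at most $6k-1$ rounds the board contains a good green $P_{4k}$.
   Context: $P_m$ denotes the path on $m$ vertices. Game: Builder and Painter play on an infinite vertex set, initially with no edges; in each round Builder draws an edge between two nonadjacent vertices and Painter immediately colors it red, blue or green. A green path is a path all of whose edges are green. A green path is called good if at least one of its endpoints is incident to a red or blue edge, and bad otherwise. *)

theory Defs
  imports Main
begin

datatype colour = Red | Blue | Green

text \<open>A position of the game is the list of all rounds played so far, oldest first; each round
  records the edge drawn by Builder (an unordered pair of vertices) and the colour given to it by
  Painter. The board is the underlying edge-coloured graph.\<close>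

type_synonym 'v position = "('v set \<times> colour) list"

type_synonym 'v builder = "'v position \<Rightarrow> 'v set"

type_synonym 'v painter = "'v position \<Rightarrow> 'v set \<Rightarrow> colour"

definition all_edges :: "'v set \<Rightarrow> 'v set set" where
  "all_edges V = {{u, v} | u v. u \<in> V \<and> v \<in> V \<and> u \<noteq> v}"

definition legal_position :: "'v set \<Rightarrow> 'v position \<Rightarrow> bool" where
  "legal_position V h \<longleftrightarrow> distinct (map fst h) \<and> fst ` set h \<subseteq> all_edges V"

text \<open>A strategy of Builder always draws an edge between two distinct, currently nonadjacent
  vertices. Painter has no restriction, so every function of type \<^typ>\<open>'v painter\<close> is a strategy
  of Painter.\<close>

definition builder_strategy :: "'v set \<Rightarrow> 'v builder \<Rightarrow> bool" where
  "builder_strategy V \<sigma> \<longleftrightarrow>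
     (\<forall>h. legal_position V h \<longrightarrow> \<sigma> h \<in> all_edges V - fst ` set h)"

primrec play :: "'v builder \<Rightarrow> 'v painter \<Rightarrow> nat \<Rightarrow> 'v position" where
  "play \<sigma> \<tau> 0 = []"
| "play \<sigma> \<tau> (Suc n) =
     (let h = play \<sigma> \<tau> n; e = \<sigma> h in h @ [(e, \<tau> h e)])"

lemma legal_position_play:
  "builder_strategy V \<sigma> \<Longrightarrow> legal_position V (play \<sigma> \<tau> n)"
  by (induction n) (auto simp: legal_position_def builder_strategy_def Let_def)

text \<open>The list \<open>p\<close> enumerates the vertices of a path (as a not necessarily induced subgraph) all of
  whose edges have colour \<open>c\<close>; it is a \<open>P\<^sub>m\<close> when \<open>length p = m\<close>.\<close>

definition mono_path :: "'v position \<Rightarrow> colour \<Rightarrow> 'v list \<Rightarrow> bool" where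
  "mono_path h c p \<longleftrightarrow> p \<noteq> [] \<and> distinct p \<and>
     (\<forall>i. Suc i < length p \<longrightarrow> ({p ! i, p ! Suc i}, c) \<in> set h)"

definition has_mono_path :: "'v position \<Rightarrow> colour \<Rightarrow> nat \<Rightarrow> bool" where
  "has_mono_path h c m \<longleftrightarrow> (\<exists>p. mono_path h c p \<and> length p = m)"

definition red_blue_incident :: "'v position \<Rightarrow> 'v \<Rightarrow> bool" where
  "red_blue_incident h v \<longleftrightarrow> (\<exists>e. v \<in> e \<and> ((e, Red) \<in> set h \<or> (e, Blue) \<in> set h))"

definition good_green_path :: "'v position \<Rightarrow> 'v list \<Rightarrow> bool" where
  "good_green_path h p \<longleftrightarrow> mono_path h Green p \<and>
     (red_blue_incident h (hd p) \<or> red_blue_incident h (last p))"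

definition bad_green_path :: "'v position \<Rightarrow> 'v list \<Rightarrow> bool" where
  "bad_green_path h p \<longleftrightarrow> mono_path h Green p \<and> \<not> good_green_path h p"

end

theory Submission
  imports Defs
begin

text \<open>
  Unless Painter loses at once, red and blue are matchings: an edge whose ends together meet both
  red and blue is forced to be green. For \<open>1 \<le> j \<le> 4\<close> this lets Builder extend a good green path by
  \<open>j\<close> vertices within \<open>j + 2\<close> rounds and any green path by \<open>j\<close> vertices within \<open>j + 3\<close> rounds, the
  result being good or completed one round earlier; the strategy touches the old path only at its two
  endpoints. So \<open>k\<close> can be increased by one at the price of six rounds, and it remains to treat
  \<open>k = 2\<close>. The finitely many local strategies are given as explicit trees, which are verified
  by evaluating a checker proved sound.
\<close>

section \<open>Winning positions for Builder\<close>

definition won :: "nat \<Rightarrow> nat \<Rightarrow> 'v position \<Rightarrow> bool" where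
  "won m r h \<longleftrightarrow> has_mono_path h Red 3 \<or> has_mono_path h Blue 3 \<or>
     (\<exists>p. mono_path h Green p \<and> length p = m \<and> (0 < r \<or> good_green_path h p))"

text \<open>The number \<open>r\<close> counts the rounds left; a green path on \<open>m\<close> vertices that Builder completes
  without a round to spare has to be good.\<close>

primrec forces :: "'v set \<Rightarrow> nat \<Rightarrow> nat \<Rightarrow> 'v position \<Rightarrow> bool" where
  "forces V m 0 h \<longleftrightarrow> won m 0 h"
| "forces V m (Suc r) h \<longleftrightarrow> won m (Suc r) h \<or>
     (\<exists>e \<in> all_edges V - fst ` set h. \<forall>c. forces V m r (h @ [(e, c)]))"

lemma won_forces: "won m r h \<Longrightarrow> forces V m r h"
  by (cases r) auto

lemma won_mono: "won m r h \<Longrightarrow> r \<le> r' \<Longrightarrow> won m r' h"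
  unfolding won_def by fastforce

text \<open>Builder keeps the same edges; spare rounds only relax the demand that the green path be
  good.\<close>

lemma forces_mono: "forces V m r h \<Longrightarrow> r \<le> r' \<Longrightarrow> forces V m r' h"
proof (induction r arbitrary: r' h)
  case 0
  then show ?case by (auto intro: won_forces won_mono)
next
  case (Suc r)
  then obtain r'' where r'': "r' = Suc r''" "r \<le> r''" by (cases r') auto
  show ?case
  proof (cases "won m (Suc r) h")
    case True
    then show ?thesis using Suc.prems(2) won_forces won_mono by blast
  next
    case False
    then obtain e where "e \<in> all_edges V - fst ` set h" "\<And>c. forces V m r (h @ [(e, c)])"
      using Suc.prems(1) by auto
    moreover from this have "\<forall>c. forces V m r'' (h @ [(e, c)])" using Suc.IH r''(2) by blast
    ultimately show ?thesis unfolding r''(1) by auto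
  qed
qed

lemma finite_vertices_of_position:
  assumes "legal_position V h"
  shows "finite (\<Union> (fst ` set h))"
  using assms by (auto simp: legal_position_def all_edges_def)

lemma legal_snoc:
  "legal_position V h \<Longrightarrow> d \<in> all_edges V - fst ` set h \<Longrightarrow> legal_position V (h @ [(d, c)])"
  by (auto simp: legal_position_def)

section \<open>From forced wins to a strategy of Builder\<close>

lemma legal_edge_exists:
  assumes "infinite V"
  shows "\<exists>e. e \<in> all_edges V - fst ` set h"
proof -
  have "infinite (all_edges V)"
  proof
    assume fin: "finite (all_edges V)"
    have "V \<subseteq> \<Union> (all_edges V)"
    proof
      fix v assume v: "v \<in> V"
      obtain u where "u \<in> V" "u \<noteq> v"
        using assms by (metis finite.emptyI finite_insert finite_subset insertI1 subsetI)
      then show "v \<in> \<Union> (all_edges V)" using v by (auto simp: all_edges_def)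
    qed
    moreover have "finite (\<Union> (all_edges V))"
      using fin by (auto simp: all_edges_def)
    ultimately show False using assms finite_subset by blast
  qed
  then show ?thesis
    by (metis finite_imageI finite_set finite_subset Diff_eq_empty_iff all_not_in_conv)
qed

lemma forces_imp_strategy:
  assumes "infinite V" "forces V m N []"
  shows "\<exists>\<sigma>. builder_strategy V \<sigma> \<and> (\<forall>\<tau>. \<exists>n\<le>N. won m (N - n) (play \<sigma> \<tau> n))"
proof -
  \<comment> \<open>The position records all rounds, so \<open>length h\<close> tells how many of
    the \<open>N\<close> rounds remain.\<close>
  define safe where "safe h e \<longleftrightarrow> e \<in> all_edges V - fst ` set h \<and>
    (\<forall>c. forces V m (N - Suc (length h)) (h @ [(e, c)]))" for h e
  define \<sigma> where "\<sigma> h = (if \<exists>e. safe h e then SOME e. safe h e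
    else SOME e. e \<in> all_edges V - fst ` set h)" for h
  have safe: "safe h (\<sigma> h)" if "\<exists>e. safe h e" for h
    using that by (simp add: \<sigma>_def someI_ex)
  have "\<sigma> h \<in> all_edges V - fst ` set h" for h
  proof (cases "\<exists>e. safe h e")
    case True
    then show ?thesis using safe safe_def by blast
  next
    case False
    then show ?thesis
      using someI_ex[OF legal_edge_exists[OF assms(1), of h]] by (simp add: \<sigma>_def)
  qed
  then have "builder_strategy V \<sigma>" by (simp add: builder_strategy_def)
  moreover have "\<exists>n\<le>N. won m (N - n) (play \<sigma> \<tau> n)" for \<tau>
  proof (rule ccontr)
    assume no: "\<not> ?thesis"
    have len: "length (play \<sigma> \<tau> n) = n" for n
      by (induction n) (auto simp: Let_def)
    \<comment> \<open>Without a win this invariant survives until no round is left, where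
      \<open>forces\<close> is just \<open>won\<close>.\<close>
    have "forces V m (N - t) (play \<sigma> \<tau> t)" if "t \<le> N" for t
      using that
    proof (induction t)
      case 0
      then show ?case using assms(2) by simp
    next
      case (Suc t)
      then have "forces V m (Suc (N - Suc t)) (play \<sigma> \<tau> t)" by (simp add: Suc_diff_Suc)
      moreover have "\<not> won m (Suc (N - Suc t)) (play \<sigma> \<tau> t)"
        using no Suc.prems by (simp add: Suc_diff_Suc)
      ultimately have "\<exists>e. safe (play \<sigma> \<tau> t) e" by (auto simp: safe_def len)
      then show ?case using safe[of "play \<sigma> \<tau> t"] by (simp add: safe_def len Let_def)
    qed
    from this[of N] show False using no by auto
  qed
  ultimately show ?thesis by blast
qed

section \<open>Monochromatic paths\<close>

lemma mono_path_iff_successively: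
  "mono_path h c p \<longleftrightarrow>
     p \<noteq> [] \<and> distinct p \<and> successively (\<lambda>u v. ({u, v}, c) \<in> set h) p"
  by (auto simp: mono_path_def successively_conv_nth)

lemma mono_path_rev: "mono_path h c (rev p) \<longleftrightarrow> mono_path h c p"
  by (simp add: mono_path_iff_successively successively_rev insert_commute)

lemma mono_path_subset:
  assumes "legal_position V h" "mono_path h c p" "2 \<le> length p"
  shows "set p \<subseteq> V"
proof
  fix v assume "v \<in> set p"
  then obtain i where i: "i < length p" "v = p ! i" by (metis in_set_conv_nth)
  have edge: "{p ! j, p ! Suc j} \<subseteq> V" if "Suc j < length p" for j
  proof -
    have "({p ! j, p ! Suc j}, c) \<in> set h" using assms(2) that by (simp add: mono_path_def)
    then have "{p ! j, p ! Suc j} \<in> all_edges V"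
      using assms(1) by (force simp: legal_position_def)
    then show ?thesis by (auto simp: all_edges_def doubleton_eq_iff)
  qed
  show "v \<in> V"
  proof (cases "Suc i < length p")
    case True
    then show ?thesis using edge i by blast
  next
    case False
    then have "Suc (i - 1) < length p" "Suc (i - 1) = i" using i assms(3) by auto
    then show ?thesis using edge[of "i - 1"] i by simp
  qed
qed

text \<open>This turns a \<open>Trap\<close> into a loss for Painter.\<close>

lemma two_edges_mono_path_3:
  assumes "legal_position V h" "(d, c) \<in> set h" "(e, c) \<in> set h" "d \<noteq> e" "v \<in> d" "v \<in> e"
  shows "has_mono_path h c 3"
proof -
  have "d \<in> all_edges V" "e \<in> all_edges V"
    using assms(1-3) by (force simp: legal_position_def)+
  then obtain x y where xy: "d = {x, v}" "x \<noteq> v" "e = {v, y}" "y \<noteq> v"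
    using assms(5,6) unfolding all_edges_def by (auto; metis insert_commute)
  then have "mono_path h c [x, v, y]"
    using assms(2-4) by (auto simp: mono_path_iff_successively)
  then show ?thesis unfolding has_mono_path_def by force
qed

section \<open>Strategy trees\<close>

text \<open>Vertices are labelled by numbers: \<open>0\<close> and \<open>e\<close> are the first and the last vertex of a given green
  path (\<open>e = 0\<close> if it has a single vertex), all other labels stand for vertices not used so
  far. A tree \<open>Draw u v t\<^sub>R t\<^sub>B t\<^sub>G\<close> tells Builder how to go on after each answer to the edge \<open>uv\<close>.
  At \<open>Trap\<close> the last edge has completed a red or blue \<open>P\<^sub>3\<close>, and \<open>Reach xs ys\<close> extends
  the given path by \<open>xs\<close> before its first and \<open>ys\<close> after its last vertex.\<close>

datatype strat = Trap | Reach "nat list" "nat list" | Draw nat nat strat strat strat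

type_synonym board = "(nat \<times> nat \<times> colour) list"

text \<open>The first disjunct accounts for an edge drawn before the tree starts, which
  \<open>s\<close> does not contain.\<close>

definition incident :: "bool \<Rightarrow> board \<Rightarrow> nat \<Rightarrow> colour \<Rightarrow> bool" where
  "incident g s u c \<longleftrightarrow> g \<and> u = 0 \<and> c = Red \<or> (\<exists>(x, y, d) \<in> set s. d = c \<and> (u = x \<or> u = y))"

definition joined :: "board \<Rightarrow> colour \<Rightarrow> nat \<Rightarrow> nat \<Rightarrow> bool" where
  "joined s c u v \<longleftrightarrow> (u, v, c) \<in> set s \<or> (v, u, c) \<in> set s"

text \<open>The number of rounds that suffice to extend a green path by \<open>j \<le> 4\<close> vertices; \<open>b\<close> tells
  whether the path is known to be good.\<close>

definition rounds :: "nat \<Rightarrow> bool \<Rightarrow> nat" where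
  "rounds j b = (if j = 0 then 0 else j + 2) + (if b then 0 else 1)"

text \<open>A sufficient criterion: older edges count only through \<open>g\<close>, so
  \<open>False\<close> means "not known to be good".\<close>

definition ext_good :: "nat \<Rightarrow> bool \<Rightarrow> board \<Rightarrow> nat list \<Rightarrow> nat list \<Rightarrow> bool" where
  "ext_good e g s xs ys \<longleftrightarrow>
     (\<exists>u \<in> {hd (xs @ [0]), last (e # ys)}. incident g s u Red \<or> incident g s u Blue)"

text \<open>The given path is to be extended by \<open>j\<close> vertices, and \<open>g\<close> says that its first vertex is
  incident to a red edge. \<open>K\<close> lists the extension problems considered as solved.\<close>

fun check :: "nat \<Rightarrow> bool \<Rightarrow> (nat \<Rightarrow> bool \<Rightarrow> bool) \<Rightarrow> nat \<Rightarrow> nat \<Rightarrow> board \<Rightarrow> strat \<Rightarrow> bool" where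
  "check e g K j r s Trap \<longleftrightarrow> (case s of [] \<Rightarrow> False
     | (u, v, c) # s' \<Rightarrow> c \<noteq> Green \<and> (incident g s' u c \<or> incident g s' v c))"
| "check e g K j r s (Reach xs ys) \<longleftrightarrow>
     length xs + length ys \<le> j \<and>
     K (j - (length xs + length ys)) (ext_good e g s xs ys) \<and>
     rounds (j - (length xs + length ys)) (ext_good e g s xs ys) \<le> r \<and>
     distinct (xs @ remdups [0, e] @ ys) \<and>
     successively (joined s Green) (xs @ [0]) \<and> successively (joined s Green) (e # ys)"
| "check e g K j 0 s (Draw u v tR tB tG) \<longleftrightarrow> False"
| "check e g K j (Suc r) s (Draw u v tR tB tG) \<longleftrightarrow>
     u \<noteq> v \<and> {u, v} \<noteq> {0, e} \<and> (\<forall>c \<in> {Red, Blue, Green}. \<not> joined s c u v) \<and>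
     check e g K j r ((u, v, Red) # s) tR \<and> check e g K j r ((u, v, Blue) # s) tB \<and>
     check e g K j r ((u, v, Green) # s) tG"

text \<open>The rest of the position is arbitrary, so solved problems can be chained. Two vertices
  ensure distinct endpoints, labelled 0 and 1.\<close>

definition extendable :: "'v set \<Rightarrow> nat \<Rightarrow> nat \<Rightarrow> bool \<Rightarrow> bool" where
  "extendable V m j b \<longleftrightarrow> (\<forall>h p r. legal_position V h \<longrightarrow> mono_path h Green p \<longrightarrow>
     2 \<le> length p \<longrightarrow> length p + j = m \<longrightarrow> (b \<longrightarrow> good_green_path h p) \<longrightarrow> rounds j b \<le> r \<longrightarrow>
     forces V m r h)"

section \<open>Soundness of the checker\<close>

text \<open>A tree is played on a real board by placing label \<open>i\<close> at
  \<open>f i\<close>. Renaming colours by \<pi> lets the known non-green edge at the first vertex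
  count as red.\<close>

locale labelling =
  fixes V :: "'v set" and h :: "'v position" and p :: "'v list" and e :: nat and g :: bool
    and f :: "nat \<Rightarrow> 'v" and \<pi> :: "colour \<Rightarrow> colour"
  assumes legal: "legal_position V h"
    and path: "mono_path h Green p"
    and inj_f: "inj f"
    and range_f: "range f \<subseteq> V"
    and f_0: "f 0 = hd p"
    and f_e: "f e = last p"
    and fresh: "\<And>i. i \<noteq> 0 \<Longrightarrow> i \<noteq> e \<Longrightarrow> f i \<notin> set p \<union> \<Union> (fst ` set h)"
    and good_0: "g \<Longrightarrow> \<exists>d. f 0 \<in> d \<and> (d, \<pi> Red) \<in> set h"
    and bij_\<pi>: "bij \<pi>"
    and \<pi>_Green: "\<pi> Green = Green"
begin

text \<open>Boards list the newest edge first, positions the oldest first.\<close>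

definition pos :: "board \<Rightarrow> 'v position" where
  "pos s = h @ rev (map (\<lambda>(u, v, c). ({f u, f v}, \<pi> c)) s)"

lemma pos_Nil: "pos [] = h"
  by (simp add: pos_def)

lemma pos_Cons: "pos ((u, v, c) # s) = pos s @ [({f u, f v}, \<pi> c)]"
  by (simp add: pos_def)

lemma set_pos: "set (pos s) = set h \<union> (\<lambda>(u, v, c). ({f u, f v}, \<pi> c)) ` set s"
  by (simp add: pos_def)

lemma \<pi>_nongreen: "c \<noteq> Green \<Longrightarrow> \<pi> c = Red \<or> \<pi> c = Blue"
  using injD[OF bij_is_inj[OF bij_\<pi>], of c Green] \<pi>_Green by (cases "\<pi> c") auto

lemma incident_pos:
  assumes "incident g s u c"
  shows "\<exists>d. f u \<in> d \<and> (d, \<pi> c) \<in> set (pos s)"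
proof -
  consider "g" "u = 0" "c = Red" | x y where "(x, y, c) \<in> set s" "u = x \<or> u = y"
    using assms by (auto simp: incident_def)
  then show ?thesis
  proof cases
    case 1
    then show ?thesis using good_0 unfolding set_pos by blast
  next
    case 2
    then have "({f x, f y}, \<pi> c) \<in> set (pos s)" unfolding set_pos by force
    then show ?thesis using 2(2) by blast
  qed
qed

lemma joined_pos:
  assumes "joined s c u v"
  shows "({f u, f v}, \<pi> c) \<in> set (pos s)"
proof -
  have "({f x, f y}, \<pi> c) \<in> set (pos s)" if "(x, y, c) \<in> set s" for x y
    using that unfolding set_pos by force
  from this[of u v] this[of v u] show ?thesis
    using assms by (auto simp: joined_def insert_commute)
qed

text \<open>All labels except 0 and \<open>e\<close> are fresh, so among the older edges only one
  joining the two endpoints could clash.\<close>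

lemma new_edge:
  assumes "u \<noteq> v" "{u, v} \<noteq> {0, e}" "\<forall>c \<in> {Red, Blue, Green}. \<not> joined s c u v"
  shows "{f u, f v} \<in> all_edges V - fst ` set (pos s)"
proof -
  have "{f u, f v} \<in> all_edges V"
    unfolding all_edges_def using range_f inj_f assms(1) by (blast dest: injD)
  moreover have "{f u, f v} \<notin> fst ` set h"
  proof
    assume "{f u, f v} \<in> fst ` set h"
    then have "f u \<in> \<Union> (fst ` set h)" "f v \<in> \<Union> (fst ` set h)" by blast+
    then have "u \<in> {0, e}" "v \<in> {0, e}" using fresh by blast+
    then show False using assms(1,2) by auto
  qed
  moreover have "{f u, f v} \<noteq> {f x, f y}" if "(x, y, c) \<in> set s" for x y c
  proof
    assume "{f u, f v} = {f x, f y}"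
    then have "u = x \<and> v = y \<or> u = y \<and> v = x"
      using inj_f by (auto simp: doubleton_eq_iff inj_eq)
    then have "joined s c u v" using that by (auto simp: joined_def)
    then show False using assms(3) by (cases c) auto
  qed
  ultimately show ?thesis unfolding set_pos by fastforce
qed

lemma trap_won:
  assumes legal': "legal_position V (pos ((u, v, c) # s))"
    and c: "c \<noteq> Green" and inc: "incident g s u c \<or> incident g s v c"
  shows "won m r (pos ((u, v, c) # s))"
proof -
  obtain w d where d: "w \<in> {f u, f v}" "w \<in> d" "(d, \<pi> c) \<in> set (pos s)"
    using inc incident_pos by blast
  \<comment> \<open>Legality excludes repeated edges, so \<open>d\<close> and the new edge are two
    different edges meeting in \<open>w\<close>.\<close>
  have "{f u, f v} \<notin> fst ` set (pos s)"
    using legal' by (auto simp: pos_Cons legal_position_def)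
  then have "d \<noteq> {f u, f v}" using d(3) by force
  then have "has_mono_path (pos ((u, v, c) # s)) (\<pi> c) 3"
    using two_edges_mono_path_3[OF legal', of d "\<pi> c" "{f u, f v}" w] d by (simp add: pos_Cons)
  then show ?thesis using \<pi>_nongreen[OF c] by (auto simp: won_def)
qed

text \<open>Fresh labels avoid \<open>p\<close>; \<open>remdups\<close> covers a single-vertex path,
  where \<open>e = 0\<close>.\<close>

lemma extension_mono_path:
  assumes dist: "distinct (xs @ remdups [0, e] @ ys)"
    and xs: "successively (joined s Green) (xs @ [0])"
    and ys: "successively (joined s Green) (e # ys)"
  shows "mono_path (pos s) Green (map f xs @ p @ map f ys)"
proof -
  let ?R = "\<lambda>u v. ({u, v}, Green) \<in> set (pos s)"
  have "\<forall>i \<in> set xs \<union> set ys. i \<noteq> 0 \<and> i \<noteq> e" using dist by (auto split: if_splits)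
  then have "set (map f xs @ map f ys) \<inter> set p = {}" using fresh by auto
  moreover have "distinct (map f (xs @ ys))"
    using dist unfolding distinct_map by (auto intro: inj_on_subset[OF inj_f])
  moreover have "p \<noteq> []" "distinct p" using path by (auto simp: mono_path_def)
  ultimately have "distinct (map f xs @ p @ map f ys)" by auto
  moreover have map: "successively ?R (map f zs)" if "successively (joined s Green) zs" for zs
    unfolding successively_map
    by (rule successively_mono[OF that]) (use joined_pos[of s Green] in \<open>simp add: \<pi>_Green\<close>)
  have "successively ?R p"
    using path by (auto simp: mono_path_iff_successively set_pos elim: successively_mono)
  then have "successively ?R (map f xs @ p @ map f ys)"
    using map[OF xs] map[OF ys] \<open>p \<noteq> []\<close> f_0 f_e
    by (auto simp: successively_append_iff successively_Cons)
  ultimately show ?thesis using \<open>p \<noteq> []\<close> by (simp add: mono_path_iff_successively)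
qed

lemma extension_good:
  assumes "ext_good e g s xs ys" "mono_path (pos s) Green (map f xs @ p @ map f ys)"
  shows "good_green_path (pos s) (map f xs @ p @ map f ys)"
proof -
  have ne: "p \<noteq> []" using path by (auto simp: mono_path_def)
  obtain u c where u: "u = hd (xs @ [0]) \<or> u = last (e # ys)" "incident g s u c" "c \<noteq> Green"
    using assms(1) by (auto simp: ext_good_def)
  have "red_blue_incident (pos s) (f u)"
    using incident_pos[OF u(2)] \<pi>_nongreen[OF u(3)] by (auto simp: red_blue_incident_def)
  moreover have "f (hd (xs @ [0])) = hd (map f xs @ p @ map f ys)"
    using ne f_0 by (cases xs) auto
  moreover have "f (last (e # ys)) = last (map f xs @ p @ map f ys)"
    using ne f_e by (cases ys rule: rev_cases) auto
  ultimately show ?thesis using u(1) assms(2) by (auto simp: good_green_path_def)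
qed

lemma check_sound:
  assumes K: "\<forall>i b. K i b \<longrightarrow> extendable V m i b \<and> i + 2 \<le> m"
    and j: "length p + j = m"
  shows "check e g K j r s t \<Longrightarrow> legal_position V (pos s) \<Longrightarrow> forces V m r (pos s)"
proof (induction t arbitrary: r s)
  case Trap
  then obtain u v c s' where "s = (u, v, c) # s'"
    by (auto split: list.splits)
  then show ?case using Trap trap_won by (auto intro!: won_forces)
next
  case (Reach xs ys)
  let ?q = "map f xs @ p @ map f ys" and ?i = "j - (length xs + length ys)"
  let ?b = "ext_good e g s xs ys"
  have q: "mono_path (pos s) Green ?q" using extension_mono_path Reach.prems(1) by simp
  have good: "?b \<longrightarrow> good_green_path (pos s) ?q" using extension_good q by blast
  have i: "extendable V m ?i ?b" "?i + 2 \<le> m" using K Reach.prems(1) by auto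
  have len: "length ?q + ?i = m" using j Reach.prems(1) by auto
  then have "2 \<le> length ?q" using i(2) by linarith
  moreover have "rounds ?i ?b \<le> r" using Reach.prems(1) by simp
  ultimately show ?case
    using i(1) len q good Reach.prems(2) unfolding extendable_def by blast
next
  case (Draw u v tR tB tG)
  then obtain r' where r: "r = Suc r'" by (cases r) auto
  have new: "{f u, f v} \<in> all_edges V - fst ` set (pos s)"
    using Draw.prems(1) unfolding r by (intro new_edge) auto
  have "forces V m r' (pos ((u, v, c) # s))" for c
  proof -
    have "legal_position V (pos ((u, v, c) # s))"
      using legal_snoc[OF Draw.prems(2) new] by (simp add: pos_Cons)
    then show ?thesis using Draw.IH Draw.prems(1) unfolding r by (cases c) auto
  qed
  then have forces: "forces V m r' (pos s @ [({f u, f v}, \<pi> c)])" for c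
    by (simp add: pos_Cons)
  \<comment> \<open>Every answer of Painter is the \<pi>-image of a colour treated by the
    tree.\<close>
  have "forces V m r' (pos s @ [({f u, f v}, c)])" for c
    using forces bij_\<pi> by (metis bij_pointE)
  then show ?case using new unfolding r by auto
qed

end

lemma fresh_labelling:
  fixes V :: "'v set"
  assumes "infinite V" "finite A" "a \<in> V" "b \<in> V" "a \<in> A" "b \<in> A" "a = b \<longleftrightarrow> e = 0"
  obtains f :: "nat \<Rightarrow> 'v" where "inj f" "range f \<subseteq> V" "f 0 = a" "f e = b"
    "\<And>i. i \<noteq> 0 \<Longrightarrow> i \<noteq> e \<Longrightarrow> f i \<notin> A"
proof -
  have "infinite (V - A)" using assms by auto
  then obtain f' :: "nat \<Rightarrow> 'v" where f': "inj f'" "range f' \<subseteq> V - A"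
    using infinite_countable_subset by blast
  define f where "f i = (if i = 0 then a else if i = e then b else f' i)" for i
  have f'_out: "f' i \<in> V" "f' i \<notin> A" for i using f'(2) by auto
  show ?thesis
  proof (rule that[of f])
    show "inj f"
      using f'(1) f'_out assms by (auto simp: f_def inj_def split: if_splits)
  qed (use f'_out assms in \<open>auto simp: f_def\<close>)
qed

text \<open>Two symmetries justify the normal form: reversing the path puts a good end first, and
  swapping red with blue makes its edge red.\<close>

lemma check_forces:
  assumes V: "infinite V" and legal: "legal_position V h" and path: "mono_path h Green p"
    and p: "set p \<subseteq> V" "length p + j = m" "e = (if length p = 1 then 0 else 1)"
    and good: "g \<Longrightarrow> good_green_path h p"
    and K: "\<forall>i b. K i b \<longrightarrow> extendable V m i b \<and> i + 2 \<le> m"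
    and check: "check e g K j r [] t"
  shows "forces V m r h"
proof -
  obtain p' where p': "mono_path h Green p'" "set p' = set p" "length p' = length p"
    "g \<Longrightarrow> red_blue_incident h (hd p')"
  proof (cases "red_blue_incident h (hd p)")
    case True
    then show ?thesis using that[of p] path by simp
  next
    case False
    moreover have "p \<noteq> []" using path by (simp add: mono_path_def)
    ultimately show ?thesis
      using that[of "rev p"] path good by (auto simp: mono_path_rev hd_rev good_green_path_def)
  qed
  have ne: "p' \<noteq> []" and dist: "distinct p'" using p'(1) by (auto simp: mono_path_def)
  have "hd p' = last p' \<longleftrightarrow> e = 0"
    using ne dist p(3) p'(3) by (cases p') auto
  then obtain f :: "nat \<Rightarrow> 'a" where f: "inj f" "range f \<subseteq> V" "f 0 = hd p'" "f e = last p'"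
    "\<And>i. i \<noteq> 0 \<Longrightarrow> i \<noteq> e \<Longrightarrow> f i \<notin> set p' \<union> \<Union> (fst ` set h)"
    using fresh_labelling[OF V, of "set p' \<union> \<Union> (fst ` set h)" "hd p'" "last p'" e]
      finite_vertices_of_position[OF legal] hd_in_set[OF ne] last_in_set[OF ne] p(1) p'(2)
    by blast
  obtain \<pi> where \<pi>: "bij \<pi>" "\<pi> Green = Green" "g \<Longrightarrow> \<exists>d. f 0 \<in> d \<and> (d, \<pi> Red) \<in> set h"
  proof (cases "g \<longrightarrow> (\<exists>d. f 0 \<in> d \<and> (d, Red) \<in> set h)")
    case True
    then show ?thesis using that[of id] by auto
  next
    case False
    define \<pi> where "\<pi> = (\<lambda>c. case c of Red \<Rightarrow> Blue | Blue \<Rightarrow> Red | Green \<Rightarrow> Green)"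
    have "\<pi> \<circ> \<pi> = id" by (auto simp: \<pi>_def split: colour.splits)
    then have "bij \<pi>" using o_bij by blast
    then show ?thesis
      using that[of \<pi>] False p'(4) f(3) by (auto simp: \<pi>_def red_blue_incident_def)
  qed
  interpret labelling V h p' e g f \<pi>
    by unfold_locales (fact legal p'(1) f \<pi>)+
  have "length p' + j = m" using p(2) p'(3) by simp
  from check_sound[OF K this check] show ?thesis using legal by (simp add: pos_Nil)
qed

section \<open>Builder's strategy\<close>

text \<open>Mirrors a tree for \<open>Draw_sym\<close>, which is applied only while all edges known
  to the tree are green.\<close>

primrec swap_strat :: "strat \<Rightarrow> strat" where
  "swap_strat Trap = Trap"
| "swap_strat (Reach xs ys) = Reach xs ys"
| "swap_strat (Draw u v tR tB tG) = Draw u v (swap_strat tB) (swap_strat tR) (swap_strat tG)"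

abbreviation Draw_sym :: "nat \<Rightarrow> nat \<Rightarrow> strat \<Rightarrow> strat \<Rightarrow> strat" where
  "Draw_sym u v tB tG \<equiv> Draw u v (swap_strat tB) tB tG"

abbreviation Forced :: "nat \<Rightarrow> nat \<Rightarrow> strat \<Rightarrow> strat" where
  "Forced u v tG \<equiv> Draw u v Trap Trap tG"

text \<open>The following trees are smallest possible ones, found by exhaustive search. In \<open>extend_j\<close>
  vertex \<open>0\<close> is an end of the given path that meets a red edge, and \<open>build_8\<close> starts from
  the empty board.\<close>

definition extend_1 :: strat where
  "extend_1 =
    Draw 0 2 Trap (Forced 0 3 (Reach [3] [])) (Reach [2] [])"

definition extend_2 :: strat where
  "extend_2 =
    Draw 1 2
      (Draw 0 2
        Trap
        (Forced 0 3 (Forced 2 3 (Reach [2, 3] [])))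
        (Draw 1 3 Trap (Forced 1 4 (Reach [2] [4])) (Reach [2] [3])))
      (Forced 0 2 (Draw 1 3 (Forced 1 4 (Reach [2] [4])) Trap (Reach [2] [3])))
      (Reach [] [2])"

definition extend_3 :: strat where
  "extend_3 =
    Draw 1 2
      (Draw 1 3
        Trap
        (Forced 0 3 (Forced 1 4 (Forced 2 3 (Reach [2, 3] [4]))))
        (Draw 0 4
          Trap
          (Forced 0 2 (Forced 2 4 (Reach [4, 2] [3])))
          (Draw 2 3 Trap (Forced 2 4 (Reach [2, 4] [3])) (Reach [4] [3, 2]))))
      (Draw 1 3
        (Forced 0 2 (Forced 1 4 (Forced 2 3 (Reach [3, 2] [4]))))
        Trap
        (Draw 2 4
          (Forced 2 3 (Forced 2 5 (Reach [] [3, 2, 5])))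
          Trap
          (Forced 0 2 (Reach [4, 2] [3]))))
      (Reach [] [2])"

definition extend_4 :: strat where
  "extend_4 =
    Draw 2 3
      (Draw 2 4
        Trap
        (Forced 0 4 (Forced 1 2 (Forced 2 5 (Forced 3 4 (Reach [3, 4] [2, 5])))))
        (Draw 0 3
          Trap
          (Forced 0 4 (Forced 1 3 (Forced 3 5 (Reach [2, 4] [3, 5]))))
          (Draw 2 5
            Trap
            (Forced 1 2 (Forced 3 5 (Reach [5, 3] [2, 4])))
            (Draw 3 4 Trap (Forced 3 5 (Reach [4, 2, 5, 3] [])) (Reach [5, 2, 4, 3] [])))))
      (Forced 0 2
        (Draw 3 4
          (Forced 1 3 (Forced 2 4 (Forced 3 5 (Reach [4, 2] [3, 5]))))
          Trap
          (Draw 2 5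
            (Forced 2 4 (Forced 3 5 (Reach [5, 3, 4, 2] [])))
            Trap
            (Draw 1 3 (Forced 3 5 (Reach [4, 3, 5, 2] [])) Trap (Reach [5, 2] [3, 4])))))
      (Draw 0 4
        Trap
        (Forced 0 5
          (Draw 1 4
            (Forced 2 4 (Forced 4 5 (Reach [3, 2, 4, 5] [])))
            Trap
            (Draw 2 4 (Forced 3 4 (Reach [5] [4, 3, 2])) Trap (Reach [5] [4, 2, 3]))))
        (Draw 1 2
          (Draw 1 5
            Trap
            (Forced 1 3 (Forced 2 5 (Reach [4] [3, 2, 5])))
            (Draw 2 4 Trap (Forced 2 5 (Reach [4] [5, 2, 3])) (Reach [3, 2, 4] [5])))
          (Draw 1 5
            (Forced 1 3 (Forced 2 5 (Reach [4] [3, 2, 5])))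
            Trap
            (Draw 2 4 (Forced 2 5 (Reach [4] [5, 2, 3])) Trap (Reach [3, 2, 4] [5])))
          (Draw 5 6
            (Draw 3 5 Trap (Forced 3 6 (Reach [4] [2, 3, 6])) (Reach [4] [2, 3, 5]))
            (Draw 3 5 (Forced 3 6 (Reach [4] [2, 3, 6])) Trap (Reach [4] [2, 3, 5]))
            (Draw 0 5 Trap (Forced 0 6 (Reach [5, 6] [2, 3])) (Reach [6, 5] [2, 3])))))"

definition build_8 :: strat where
  "build_8 =
    Draw_sym 0 1
      (Draw 0 2
        (Forced 0 3 (Forced 0 4
          (Draw 1 3
            (Forced 1 4 (Forced 1 5
              (Draw 2 6
                Trap
                (Forced 2 5 (Forced 2 7 (Forced 3 6 (Reach [6, 3] [4, 1, 5, 2, 7]))))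
                (Draw 2 7
                  Trap
                  (Forced 2 5 (Forced 3 7 (Reach [6, 2, 5, 1, 4] [3, 7])))
                  (Draw 3 6
                    Trap
                    (Forced 3 7 (Reach [5, 1, 4] [3, 7, 2, 6]))
                    (Reach [5, 1, 4] [3, 6, 2, 7]))))))
            Trap
            (Reach [1, 3] [4]))))
        Trap
        (Draw 1 3
          (Forced 0 3 (Forced 1 2 (Reach [1, 2] [3])))
          Trap
          (Draw 0 4
            (Forced 0 3 (Reach [1, 3] [2]))
            Trap
            (Draw 1 2 (Forced 1 4 (Reach [2] [4, 1, 3])) Trap (Reach [] [2, 1, 3])))))
      (Draw_sym 0 2
        (Draw 2 3
          (Forced 0 3 (Forced 1 2 (Reach [2, 1] [3])))
          Trap
          (Draw 0 4
            (Forced 0 3 (Reach [1] [3, 2]))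
            Trap
            (Draw 1 2 (Forced 2 4 (Reach [1] [4, 2, 3])) Trap (Reach [] [1, 2, 3]))))
        (Draw_sym 1 3
          (Draw 3 4
            (Forced 1 4 (Reach [2] [1, 4]))
            Trap
            (Draw 0 3 (Forced 2 3 (Reach [1] [2, 3, 4])) Trap (Reach [1] [3, 4])))
          (Reach [2] [1, 3])))"

section \<open>Extending green paths by at most four vertices\<close>

lemma extendable_0: "extendable V m 0 b"
  \<comment> \<open>For a path not known to be good, \<open>rounds 0 False = 1\<close> is the spare
    round asked for by \<open>won\<close>.\<close>
  by (auto simp: extendable_def rounds_def won_def intro!: won_forces split: if_splits)

lemma extendable_check:
  assumes "infinite V" "check 1 b K j (rounds j b) [] t"
    and K: "\<And>i b'. K i b' \<Longrightarrow> i \<le> j \<and> extendable V m i b'"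
  shows "extendable V m j b"
  unfolding extendable_def
proof (intro allI impI)
  fix h p r
  assume p: "legal_position V h" "mono_path h Green p" "2 \<le> length p" "length p + j = m"
    "b \<longrightarrow> good_green_path h p" and r: "rounds j b \<le> r"
  have "\<forall>i b'. K i b' \<longrightarrow> extendable V m i b' \<and> i + 2 \<le> m"
    using K p(3,4) by fastforce
  then have "forces V m (rounds j b) h"
    using p mono_path_subset[OF p(1-3)] assms(2)
    by (intro check_forces[OF assms(1) p(1,2), of j m 1 b K _ t]) auto
  then show "forces V m r h" using r forces_mono by blast
qed

text \<open>In the general case both answers to the first edge leave \<open>j + 2\<close> rounds,
  enough for a good path lacking \<open>j\<close> vertices or any path lacking
  \<open>j - 1\<close>.\<close>

lemma extendable_step:
  assumes "infinite V" "0 < j" "check 1 True (\<lambda>i b. i < j) j (j + 2) [] t"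
    and less: "\<And>i b. i < j \<Longrightarrow> extendable V m i b"
  shows "extendable V m j b"
proof -
  have good: "extendable V m j True"
    by (rule extendable_check[OF assms(1), where t = t and K = "\<lambda>i b. i < j"])
      (use assms in \<open>auto simp: rounds_def\<close>)
  \<comment> \<open>An arbitrary path becomes good or longer when its first vertex is joined to a new one.\<close>
  have "extendable V m j False"
    by (rule extendable_check[OF assms(1), where K = "\<lambda>i b. i < j \<or> i = j \<and> b"
          and t = "Draw_sym 0 2 (Reach [] []) (Reach [2] [])"])
      (use assms good in \<open>auto simp: rounds_def ext_good_def incident_def joined_def\<close>)
  with good show ?thesis by (cases b) auto
qed

lemma check_extend:
  "check 1 True (\<lambda>i b. i < 1) 1 (1 + 2) [] extend_1"
  "check 1 True (\<lambda>i b. i < 2) 2 (2 + 2) [] extend_2"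
  "check 1 True (\<lambda>i b. i < 3) 3 (3 + 2) [] extend_3"
  "check 1 True (\<lambda>i b. i < 4) 4 (4 + 2) [] extend_4"
  by code_simp+

text \<open>A single vertex lacks 7 of 8 vertices; branches may stop once at most 4 are
  lacking.\<close>

lemma check_build_8: "check 0 False (\<lambda>i b. i \<le> 4) 7 11 [] build_8"
  by code_simp

lemma extendable_le_4:
  assumes "infinite V" "j \<le> 4"
  shows "extendable V m j b"
  using assms(2)
proof (induction j arbitrary: b rule: less_induct)
  case (less j)
  have "\<exists>t. check 1 True (\<lambda>i b. i < j) j (j + 2) [] t" if "0 < j"
  proof -
    have "j = 1 \<or> j = 2 \<or> j = 3 \<or> j = 4" using that less.prems by linarith
    then show ?thesis using check_extend by (elim disjE) (hypsubst, rule exI, assumption)+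
  qed
  moreover have "\<And>i b. i < j \<Longrightarrow> extendable V m i b" using less by simp
  ultimately show ?case
    using extendable_0 extendable_step[OF assms(1)] by (metis gr0I)
qed

section \<open>Induction on \<open>k\<close>\<close>

lemma forces_8:
  assumes "infinite V"
  shows "forces V 8 11 []"
proof -
  obtain v where "v \<in> V" using assms by (metis finite.emptyI ex_in_conv)
  then show ?thesis
    using check_build_8 extendable_le_4[OF assms]
    by (intro check_forces[OF assms, of _ "[v]" 7 8 0 False "\<lambda>i b. i \<le> 4"])
      (auto simp: legal_position_def mono_path_def)
qed

text \<open>Builder plays for \<open>m\<close> vertices first and extends the path once that is
  won.\<close>

lemma forces_add_4:
  assumes "infinite V" "2 \<le> m"
  shows "forces V m r h \<Longrightarrow> legal_position V h \<Longrightarrow> forces V (m + 4) (r + 6) h"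
proof (induction r arbitrary: h)
  have won: "forces V (m + 4) (r + 6) h" if won: "won m r h" and legal: "legal_position V h" for r h
  proof (cases "has_mono_path h Red 3 \<or> has_mono_path h Blue 3")
    case True
    then show ?thesis by (auto simp: won_def intro!: won_forces)
  next
    case False
    then obtain p where p: "mono_path h Green p" "length p = m" "0 < r \<or> good_green_path h p"
      using won by (auto simp: won_def)
    define b where "b \<longleftrightarrow> good_green_path h p"
    have "extendable V (m + 4) 4 b" using extendable_le_4[OF assms(1)] by simp
    \<comment> \<open>A good path costs 6 rounds; any other costs 7, but comes with a spare
      round.\<close>
    moreover have "rounds 4 b \<le> r + 6" using p(3) by (auto simp: rounds_def b_def)
    ultimately show ?thesis
      using legal p(1,2) assms(2) unfolding extendable_def b_def by blast
  qed
  {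
    case 0
    then show ?case using won[of 0 h] by simp
  next
    case (Suc r)
    show ?case
    proof (cases "won m (Suc r) h")
      case True
      then show ?thesis using won Suc.prems(2) by blast
    next
      case False
      then obtain e where e: "e \<in> all_edges V - fst ` set h" "\<And>c. forces V m r (h @ [(e, c)])"
        using Suc.prems(1) by auto
      have "forces V (m + 4) (r + 6) (h @ [(e, c)])" for c
        using e Suc.prems(2) by (intro Suc.IH) (auto simp: legal_position_def)
      then show ?thesis using e(1) unfolding add_Suc forces.simps by blast
    qed
  }
qed

lemma forces_4k:
  assumes "infinite V" "2 \<le> k"
  shows "forces V (4 * k) (6 * k - 1) []"
  using assms(2)
proof (induction k rule: nat_induct_at_least)
  case base
  then show ?case using forces_8[OF assms(1)] by simp
next
  case (Suc k)
  then have "forces V (4 * k + 4) (6 * k - 1 + 6) []"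
    by (intro forces_add_4[OF assms(1)]) (auto simp: legal_position_def)
  moreover have "6 * k - 1 + 6 = 6 * Suc k - 1" using Suc.hyps by simp
  ultimately show ?case by (simp add: add.commute)
qed

theorem theorem3p5:
  fixes V :: "'v set" and k :: nat
  assumes "infinite V" and "k \<ge> 2"
  shows "\<exists>\<sigma>. builder_strategy V \<sigma> \<and>
    (\<forall>\<tau>.
      (\<exists>n \<le> 6 * k - 1. has_mono_path (play \<sigma> \<tau> n) Red 3 \<or> has_mono_path (play \<sigma> \<tau> n) Blue 3) \<or>
      (\<exists>n \<le> 6 * k - 2. \<exists>p. bad_green_path (play \<sigma> \<tau> n) p \<and> length p = 4 * k) \<or>
      (\<exists>n \<le> 6 * k - 1. \<exists>p. good_green_path (play \<sigma> \<tau> n) p \<and> length p = 4 * k))"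
proof -
  obtain \<sigma> where \<sigma>: "builder_strategy V \<sigma>"
    and won: "\<And>\<tau>. \<exists>n \<le> 6 * k - 1. won (4 * k) (6 * k - 1 - n) (play \<sigma> \<tau> n)"
    using forces_imp_strategy[OF assms(1) forces_4k[OF assms]] by blast
  show ?thesis
  proof (intro exI[of _ \<sigma>] conjI allI \<sigma>)
    fix \<tau>
    obtain n where n: "n \<le> 6 * k - 1" "won (4 * k) (6 * k - 1 - n) (play \<sigma> \<tau> n)"
      using won by blast
    show "(\<exists>n \<le> 6 * k - 1. has_mono_path (play \<sigma> \<tau> n) Red 3 \<or> has_mono_path (play \<sigma> \<tau> n) Blue 3) \<or>
      (\<exists>n \<le> 6 * k - 2. \<exists>p. bad_green_path (play \<sigma> \<tau> n) p \<and> length p = 4 * k) \<or>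
      (\<exists>n \<le> 6 * k - 1. \<exists>p. good_green_path (play \<sigma> \<tau> n) p \<and> length p = 4 * k)"
    proof (cases "has_mono_path (play \<sigma> \<tau> n) Red 3 \<or> has_mono_path (play \<sigma> \<tau> n) Blue 3")
      case True
      then show ?thesis using n(1) by blast
    next
      case False
      then obtain p where p: "mono_path (play \<sigma> \<tau> n) Green p" "length p = 4 * k"
        "0 < 6 * k - 1 - n \<or> good_green_path (play \<sigma> \<tau> n) p"
        using n(2) by (auto simp: won_def)
      show ?thesis
      proof (cases "good_green_path (play \<sigma> \<tau> n) p")
        case True
        then show ?thesis using n(1) p(2) by blast
      next
        case False
        \<comment> \<open>A path that is not good wins only with a round to spare, whence the
          stricter bound.\<close>
        then have "n \<le> 6 * k - 2" "bad_green_path (play \<sigma> \<tau> n) p"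
          using p by (auto simp: bad_green_path_def)
        then show ?thesis using p(2) by blast
      qed
    qed
  qed
qed

end
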